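(* Let $\mathbb F$ be a field of characteristic $2$, let $(A,L,[\cdot,\cdot],(\cdot)^{[2]},\rho)$ be a restricted Lie-Rinehart algebra over $\mathbb F$ with associated restricted multiderivation $(m,\omega)=([\cdot,\cdot],(\cdot)^{[2]})$. If $(m_t,\omega_t)$ and $(m'_t,\omega'_t)$ are two equivalent restricted formal deformations of $(m,\omega)$, then their infinitesimals $(m_1,\omega_1)$ and $(m'_1,\omega'_1)$ are cohomologous, i.e. $(m_1+m_1',\omega_1+\omega_1')\in B^2_{*_2}(L,L)$.
   Context: All algebras are finite-dimensional. **Restricted Lie algebra (char 2).** A Lie algebra $L$ with a map $(\cdot)^{[2]}$ such that $(\lambda x)^{[2]}=\lambda^2x^{[2]}$, $[x,y^{[2]}]=[[x,y],y]$, $(x+y)^{[2]}=x^{[2]}+y^{[2]}+[x,y]$. **Restricted Lie-Rinehart algebra (char 2).** $A$ is a commutative associative $\mathbb F$-algebra, $L$ is a restricted Lie algebra and an $A$-module, $\rho:L\to\mathrm{Der}(A)$ is a morphism of Lie algebras and of $A$-modules, $[x,ay]=\rho(x)(a)y+a[x,y]$, $\rho(x^{[2]})=\rho(x)^2$, $(ax)^{[2]}=a^2x^{[2]}+\rho(ax)(a)x$. **Restricted multiderivation (char 2).** A pair $(m,\omega)$, $m:L\times L\to L$ skew-symmetric bilinear, $\omega:L\to L$ with $\omega(\lambda x)=\lambda^2\omega(x)$ and $\omega(x+y)=\omega(x)+\omega(y)+m(x,y)$, such that there is a symbol map $\sigma:L\to\mathrm{Der}(A)$ with $\sigma(ax)=a\sigma(x)$,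 $m(x,ay)=am(x,y)+\sigma(x)(a)y$, $\sigma(\omega(x))=\sigma(x)^2$, $\omega(ax)=a^2\omega(x)+\sigma(ax)(a)x$. **Restricted formal deformation of $(m,\omega)$.** $m_t=\sum_{i\ge0}t^im_i$, $\omega_t=\sum_{j\ge0}t^j\omega_j$ with $m_0=m$, $\omega_0=\omega$, each $(m_i,\omega_i)$ a restricted multiderivation with symbol map $\sigma_i$ ($\sigma_0=\rho$), such that for all $x,y,z\in L$: $m_t(x,m_t(y,z))+m_t(y,m_t(z,x))+m_t(z,m_t(x,y))=0$; $m_t(x,\omega_t(y))=m_t(m_t(x,y),y)$; $\omega_t(x+y)=\omega_t(x)+\omega_t(y)+m_t(x,y)$; $\sum_{i=0}^k\sigma_i(\omega_{k-i}(x))=\sum_{i=0}^k\sigma_i(x)\circ\sigma_{k-i}(x)$ for all $k\ge0$. The map $m_t$ is extended $\mathbb F[[t]]$-bilinearly to $L[[t]]$, and $\omega_t$ is extended by $\omega_t(\sum_it^ix_i)=\sum_it^{2i}\omega_t(x_i)+\sum_{i<j}t^{i+j}m_t(x_i,x_j)$. **Equivalence.** $(m_t,\omega_t)$ and $(m_t',\omega_t')$ are equivalent if there is $\phi_t=\sum_{i\ge0}t^i\phi_i:L[[t]]\to L[[t]]$ ($\phi_i:L\to L$ linear, $\phi_0=\mathrm{id}$, extended $\mathbb F[[t]]$-linearly) with $m_t(\phi_t(x),\phi_t(y))=\phi_t(m'_t(x,y))$ and $\phi_t(\omega_t(x))=\omega'_t(\phi_t(x))$ for all $x,y\in L$. **Coboundaries.**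 $B^2_{*_2}(L,L)$ is the set of pairs $(d^1_{CE}\psi,w)$, $\psi:L\to L$ linear, $d^1_{CE}\psi(x,y)=\psi([x,y])+[x,\psi(y)]+[y,\psi(x)]$, $w(x)=\psi(x^{[2]})+[x,\psi(x)]$. *)

theory Defs
  imports "HOL-Computational_Algebra.Formal_Power_Series"
begin

definition bilinear_on ::
  "('f::field \<Rightarrow> 'l::ab_group_add \<Rightarrow> 'l) \<Rightarrow> ('l \<Rightarrow> 'l \<Rightarrow> 'l) \<Rightarrow> bool" where
  "bilinear_on scale m \<longleftrightarrow>
     (\<forall>x. Vector_Spaces.linear scale scale (\<lambda>y. m x y)) \<and>
     (\<forall>y. Vector_Spaces.linear scale scale (\<lambda>x. m x y))"

text \<open>The algebra \<open>A\<close> is not required to have a unit; every unital commutative algebra is an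
  instance, since \<open>comm_ring_1\<close> is a subclass of \<open>comm_ring\<close>.\<close>

locale commutative_algebra = vector_space scale
  for scale :: "'f::field \<Rightarrow> 'a::comm_ring \<Rightarrow> 'a" +
  assumes scale_mult: "scale c (a * b) = scale c a * b"

definition derivations ::
  "('f::field \<Rightarrow> 'a::comm_ring \<Rightarrow> 'a) \<Rightarrow> ('a \<Rightarrow> 'a) set" where
  "derivations scale =
     {D. Vector_Spaces.linear scale scale D \<and> (\<forall>a b. D (a * b) = D a * b + a * D b)}"

locale lie_algebra = vector_space scale
  for scale :: "'f::field \<Rightarrow> 'l::ab_group_add \<Rightarrow> 'l" +
  fixes br :: "'l \<Rightarrow> 'l \<Rightarrow> 'l"
  assumes bilinear_br: "bilinear_on scale br"
    and alternating: "br x x = 0"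
    and jacobi: "br x (br y z) + br y (br z x) + br z (br x y) = 0"

text \<open>The axioms of a 2-mapping; meaningful over fields of characteristic 2, which is assumed
  separately.\<close>

locale restricted_lie_algebra = lie_algebra scale br
  for scale :: "'f::field \<Rightarrow> 'l::ab_group_add \<Rightarrow> 'l" and br :: "'l \<Rightarrow> 'l \<Rightarrow> 'l" +
  fixes sq :: "'l \<Rightarrow> 'l"
  assumes sq_scale: "sq (scale c x) = scale (c ^ 2) (sq x)"
    and br_sq: "br x (sq y) = br (br x y) y"
    and sq_add: "sq (x + y) = sq x + sq y + br x y"

text \<open>\<open>act\<close> is the action of \<open>A\<close> on \<open>L\<close>.  The library locale \<open>module\<close> is not used for it because
  it needs a unit.\<close>

locale restricted_lie_rinehart =
  A: commutative_algebra scaleA + L: restricted_lie_algebra scaleL br sq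
  for scaleA :: "'f::field \<Rightarrow> 'a::comm_ring \<Rightarrow> 'a"
    and scaleL :: "'f \<Rightarrow> 'l::ab_group_add \<Rightarrow> 'l"
    and br :: "'l \<Rightarrow> 'l \<Rightarrow> 'l"
    and sq :: "'l \<Rightarrow> 'l" +
  fixes act :: "'a \<Rightarrow> 'l \<Rightarrow> 'l"
    and rho :: "'l \<Rightarrow> 'a \<Rightarrow> 'a"
  assumes act_add_left: "act (a + b) x = act a x + act b x"
    and act_add_right: "act a (x + y) = act a x + act a y"
    and act_mult: "act (a * b) x = act a (act b x)"
    and act_scale_left: "act (scaleA c a) x = scaleL c (act a x)"
    and act_scale_right: "act a (scaleL c x) = scaleL c (act a x)"
    and rho_derivation: "rho x \<in> derivations scaleA"
    and rho_add: "rho (x + y) a = rho x a + rho y a"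
    and rho_scale: "rho (scaleL c x) a = scaleA c (rho x a)"
    and rho_br: "rho (br x y) a = rho x (rho y a) - rho y (rho x a)"
    and rho_act: "rho (act b x) a = b * rho x a"
    and leibniz: "br x (act a y) = act (rho x a) y + act a (br x y)"
    and rho_sq: "rho (sq x) = rho x \<circ> rho x"
    and sq_act: "sq (act a x) = act (a * a) (sq x) + act (rho (act a x) a) x"

definition restricted_multiderivation ::
  "('f::field \<Rightarrow> 'a::comm_ring \<Rightarrow> 'a) \<Rightarrow> ('f \<Rightarrow> 'l::ab_group_add \<Rightarrow> 'l) \<Rightarrow> ('a \<Rightarrow> 'l \<Rightarrow> 'l)
    \<Rightarrow> ('l \<Rightarrow> 'l \<Rightarrow> 'l) \<Rightarrow> ('l \<Rightarrow> 'l) \<Rightarrow> ('l \<Rightarrow> 'a \<Rightarrow> 'a) \<Rightarrow> bool" where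
  "restricted_multiderivation scaleA scaleL act m w sigma \<longleftrightarrow>
     bilinear_on scaleL m \<and>
     (\<forall>x y. m x y = - m y x) \<and>
     (\<forall>c x. w (scaleL c x) = scaleL (c ^ 2) (w x)) \<and>
     (\<forall>x y. w (x + y) = w x + w y + m x y) \<and>
     (\<forall>x. sigma x \<in> derivations scaleA) \<and>
     (\<forall>a x b. sigma (act a x) b = a * sigma x b) \<and>
     (\<forall>x a y. m x (act a y) = act a (m x y) + act (sigma x a) y) \<and>
     (\<forall>x. sigma (w x) = sigma x \<circ> sigma x) \<and>
     (\<forall>a x. w (act a x) = act (a * a) (w x) + act (sigma (act a x) a) x)"

text \<open>\<open>L[[t]]\<close> is \<open>'l fps\<close>, and \<open>fps_const\<close> embeds \<open>L\<close> into it.  A family \<open>m\<^sub>0, m\<^sub>1, \<dots>\<close> of maps on \<open>L\<close>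
  stands for \<open>m\<^sub>t = \<Sum> t\<^sup>k m\<^sub>k\<close>, and the following three operators are the extensions of such series
  to \<open>L[[t]]\<close>, written coefficientwise:
  the \<open>F[[t]]\<close>-linear extension of \<open>\<phi>\<^sub>t\<close>, the \<open>F[[t]]\<close>-bilinear extension of \<open>m\<^sub>t\<close>, and the extension
  \<open>\<omega>\<^sub>t(\<Sum> t\<^sup>i x\<^sub>i) = \<Sum> t\<^sup>2\<^sup>i \<omega>\<^sub>t(x\<^sub>i) + \<Sum>\<^bsub>i<j\<^esub> t\<^sup>i\<^sup>+\<^sup>j m\<^sub>t(x\<^sub>i, x\<^sub>j)\<close> of \<open>\<omega>\<^sub>t\<close>.\<close>

definition ext1 :: "(nat \<Rightarrow> 'l \<Rightarrow> 'l::ab_group_add) \<Rightarrow> 'l fps \<Rightarrow> 'l fps" where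
  "ext1 phi X = Abs_fps (\<lambda>n. \<Sum>(k, i) | k + i = n. phi k (fps_nth X i))"

definition ext2 ::
  "(nat \<Rightarrow> 'l \<Rightarrow> 'l \<Rightarrow> 'l::ab_group_add) \<Rightarrow> 'l fps \<Rightarrow> 'l fps \<Rightarrow> 'l fps" where
  "ext2 m X Y = Abs_fps (\<lambda>n. \<Sum>(k, i, j) | k + i + j = n. m k (fps_nth X i) (fps_nth Y j))"

definition ext_quad ::
  "(nat \<Rightarrow> 'l \<Rightarrow> 'l \<Rightarrow> 'l::ab_group_add) \<Rightarrow> (nat \<Rightarrow> 'l \<Rightarrow> 'l) \<Rightarrow> 'l fps \<Rightarrow> 'l fps" where
  "ext_quad m w X = Abs_fps (\<lambda>n.
     (\<Sum>(k, i) | k + 2 * i = n. w k (fps_nth X i)) +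
     (\<Sum>(k, i, j) | i < j \<and> k + i + j = n. m k (fps_nth X i) (fps_nth X j)))"

definition restricted_formal_deformation ::
  "('f::field \<Rightarrow> 'a::comm_ring \<Rightarrow> 'a) \<Rightarrow> ('f \<Rightarrow> 'l::ab_group_add \<Rightarrow> 'l) \<Rightarrow> ('a \<Rightarrow> 'l \<Rightarrow> 'l)
    \<Rightarrow> ('l \<Rightarrow> 'l \<Rightarrow> 'l) \<Rightarrow> ('l \<Rightarrow> 'l) \<Rightarrow> ('l \<Rightarrow> 'a \<Rightarrow> 'a)
    \<Rightarrow> (nat \<Rightarrow> 'l \<Rightarrow> 'l \<Rightarrow> 'l) \<Rightarrow> (nat \<Rightarrow> 'l \<Rightarrow> 'l) \<Rightarrow> bool" where
  "restricted_formal_deformation scaleA scaleL act m w rho mt wt \<longleftrightarrow>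
     mt 0 = m \<and> wt 0 = w \<and>
     (\<exists>sigma :: nat \<Rightarrow> 'l \<Rightarrow> 'a \<Rightarrow> 'a.
        sigma 0 = rho \<and>
        (\<forall>i. restricted_multiderivation scaleA scaleL act (mt i) (wt i) (sigma i)) \<and>
        (\<forall>k x a. (\<Sum>i\<le>k. sigma i (wt (k - i) x) a) = (\<Sum>i\<le>k. sigma i x (sigma (k - i) x a)))) \<and>
     (\<forall>x y z. let X = fps_const x; Y = fps_const y; Z = fps_const z in
        ext2 mt X (ext2 mt Y Z) + ext2 mt Y (ext2 mt Z X) + ext2 mt Z (ext2 mt X Y) = 0) \<and>
     (\<forall>x y. let X = fps_const x; Y = fps_const y in
        ext2 mt X (ext_quad mt wt Y) = ext2 mt (ext2 mt X Y) Y) \<and>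
     (\<forall>x y. let X = fps_const x; Y = fps_const y in
        ext_quad mt wt (X + Y) = ext_quad mt wt X + ext_quad mt wt Y + ext2 mt X Y)"

definition equivalent_deformations ::
  "('f::field \<Rightarrow> 'l::ab_group_add \<Rightarrow> 'l)
    \<Rightarrow> (nat \<Rightarrow> 'l \<Rightarrow> 'l \<Rightarrow> 'l) \<Rightarrow> (nat \<Rightarrow> 'l \<Rightarrow> 'l)
    \<Rightarrow> (nat \<Rightarrow> 'l \<Rightarrow> 'l \<Rightarrow> 'l) \<Rightarrow> (nat \<Rightarrow> 'l \<Rightarrow> 'l) \<Rightarrow> bool" where
  "equivalent_deformations scale mt wt mt' wt' \<longleftrightarrow>
     (\<exists>phi :: nat \<Rightarrow> 'l \<Rightarrow> 'l.
        phi 0 = id \<and>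
        (\<forall>i. Vector_Spaces.linear scale scale (phi i)) \<and>
        (\<forall>x y. ext2 mt (ext1 phi (fps_const x)) (ext1 phi (fps_const y)) =
               ext1 phi (ext2 mt' (fps_const x) (fps_const y))) \<and>
        (\<forall>x. ext1 phi (ext_quad mt wt (fps_const x)) =
             ext_quad mt' wt' (ext1 phi (fps_const x))))"

definition d1_CE ::
  "('l \<Rightarrow> 'l \<Rightarrow> 'l::ab_group_add) \<Rightarrow> ('l \<Rightarrow> 'l) \<Rightarrow> 'l \<Rightarrow> 'l \<Rightarrow> 'l" where
  "d1_CE br psi x y = psi (br x y) + br x (psi y) + br y (psi x)"

definition restricted_2_coboundaries ::
  "('f::field \<Rightarrow> 'l::ab_group_add \<Rightarrow> 'l) \<Rightarrow> ('l \<Rightarrow> 'l \<Rightarrow> 'l) \<Rightarrow> ('l \<Rightarrow> 'l)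
    \<Rightarrow> (('l \<Rightarrow> 'l \<Rightarrow> 'l) \<times> ('l \<Rightarrow> 'l)) set" where
  "restricted_2_coboundaries scale br sq =
     {(d1_CE br psi, \<lambda>x. psi (sq x) + br x (psi x)) | psi. Vector_Spaces.linear scale scale psi}"

end

theory Submission
  imports Defs
begin

text \<open>Comparing the coefficients of \<open>t\<close> in the two equivalence equations gives, in characteristic 2,
  \<open>m\<^sub>1 + m\<^sub>1' = d\<^sup>1 \<phi>\<^sub>1\<close> and \<open>\<omega>\<^sub>1(x) + \<omega>\<^sub>1'(x) = \<phi>\<^sub>1(x\<^sup>[\<^sup>2\<^sup>]) + [x, \<phi>\<^sub>1(x)]\<close>, so \<open>\<phi>\<^sub>1\<close> is the required cochain.\<close>

lemma ext1_nth_0: "fps_nth (ext1 phi X) 0 = phi 0 (fps_nth X 0)"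
proof -
  have "{(k, i). k + i = (0::nat)} = {(0, 0)}"
    by auto
  then show ?thesis
    by (simp add: ext1_def)
qed

lemma ext1_nth_1:
  "fps_nth (ext1 phi X) 1 = phi 0 (fps_nth X 1) + phi 1 (fps_nth X 0)"
proof -
  have "{(k, i). k + i = (1::nat)} = {(0, 1), (1, 0)}"
    by auto
  then show ?thesis
    by (simp add: ext1_def)
qed

lemma ext2_nth_0: "fps_nth (ext2 m X Y) 0 = m 0 (fps_nth X 0) (fps_nth Y 0)"
proof -
  have "{(k, i, j). k + i + j = (0::nat)} = {(0, 0, 0)}"
    by auto
  then show ?thesis
    by (simp add: ext2_def)
qed

lemma ext2_nth_1:
  "fps_nth (ext2 m X Y) 1 =
     m 0 (fps_nth X 0) (fps_nth Y 1) + m 0 (fps_nth X 1) (fps_nth Y 0)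
       + m 1 (fps_nth X 0) (fps_nth Y 0)"
proof -
  have "{(k, i, j). k + i + j = (1::nat)} = {(0, 0, 1), (0, 1, 0), (1, 0, 0)}"
    by auto
  then show ?thesis
    by (simp add: ext2_def add.assoc)
qed

lemma ext_quad_nth_0: "fps_nth (ext_quad m w X) 0 = w 0 (fps_nth X 0)"
proof -
  have "{(k, i). k + 2 * i = (0::nat)} = {(0, 0)}"
    by auto
  moreover have "{(k, i, j). i < j \<and> k + i + j = (0::nat)} = {}"
    by auto
  ultimately show ?thesis
    by (simp only: ext_quad_def fps_nth_Abs_fps) simp
qed

text \<open>The index \<open>i\<close> counts double in the \<open>w\<close> sum, so the coefficient
  of X at t meets \<open>w\<close> no earlier than t^2. At order one it enters only through the
  cross term of the index pair (0, 1).\<close>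

lemma ext_quad_nth_1:
  "fps_nth (ext_quad m w X) 1 =
     w 1 (fps_nth X 0) + m 0 (fps_nth X 0) (fps_nth X 1)"
proof -
  have "{(k, i). k + 2 * i = (1::nat)} = {(1, 0)}"
    by auto presburger+
  moreover have "{(k, i, j). i < j \<and> k + i + j = (1::nat)} = {(0, 0, 1)}"
    by auto
  ultimately show ?thesis
    by (simp add: ext_quad_def)
qed

text \<open>The characteristic of the field reaches the vectors through
  \<open>scale (1 + 1) x\<close>.\<close>

lemma (in vector_space) CHAR_2_add_self:
  fixes x :: 'b
  assumes "CHAR('a) = 2"
  shows "x + x = 0"
proof -
  have two: "(1 + 1 :: 'a) = 0"
    using of_nat_CHAR[where 'a = 'a] unfolding assms by (simp only: of_nat_numeral one_add_one)
  have "x + x = scale (1 + 1) x"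
    by (simp only: scale_left_distrib scale_one)
  then show ?thesis
    by (simp only: two scale_zero_left)
qed

text \<open>Constant series vanish at t; this removes the bracket terms in which that coefficient
  occurs.\<close>

lemma bilinear_on_zero:
  assumes "bilinear_on scale m"
  shows "m 0 y = 0" and "m x 0 = 0"
proof -
  have "Vector_Spaces.linear scale scale (\<lambda>x. m x y)"
    and "Vector_Spaces.linear scale scale (m x)"
    using assms by (auto simp: bilinear_on_def)
  then show "m 0 y = 0" and "m x 0 = 0"
    by (auto simp: linear_iff_module_hom dest: module_hom.zero)
qed

theorem proposition5p19:
  fixes scaleA :: "'f::field \<Rightarrow> 'a::comm_ring \<Rightarrow> 'a"
    and scaleL :: "'f \<Rightarrow> 'l::ab_group_add \<Rightarrow> 'l"
    and act :: "'a \<Rightarrow> 'l \<Rightarrow> 'l"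
    and br :: "'l \<Rightarrow> 'l \<Rightarrow> 'l" and sq :: "'l \<Rightarrow> 'l" and rho :: "'l \<Rightarrow> 'a \<Rightarrow> 'a"
    and mt mt' :: "nat \<Rightarrow> 'l \<Rightarrow> 'l \<Rightarrow> 'l" and wt wt' :: "nat \<Rightarrow> 'l \<Rightarrow> 'l"
  assumes "CHAR('f) = 2"
    and "restricted_lie_rinehart scaleA scaleL br sq act rho"
    and "\<exists>B. finite_dimensional_vector_space scaleA B"
    and "\<exists>B. finite_dimensional_vector_space scaleL B"
    and "restricted_formal_deformation scaleA scaleL act br sq rho mt wt"
    and "restricted_formal_deformation scaleA scaleL act br sq rho mt' wt'"
    and "equivalent_deformations scaleL mt wt mt' wt'"
  shows "((\<lambda>x y. mt 1 x y + mt' 1 x y), (\<lambda>x. wt 1 x + wt' 1 x))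
           \<in> restricted_2_coboundaries scaleL br sq"
proof -
  interpret restricted_lie_rinehart scaleA scaleL br sq act rho
    by fact
  have self: "x + x = 0" for x :: 'l
    using L.CHAR_2_add_self[OF assms(1)] .
  have minus: "- x = x" for x :: 'l
    using self[of x] by (simp add: minus_unique)
  have diff: "x - y = x + y" for x y :: 'l
    by (simp add: diff_conv_add_uminus minus del: add_uminus_conv_diff)
  \<comment> \<open>\<open>ac_simps\<close> nests sums to the right, so a repeated summand shows up
    in this shape rather than as \<open>x + x\<close>.\<close>
  have cancel: "x + (x + y) = y" for x y :: 'l
    by (simp add: self flip: add.assoc)
  have base: "mt 0 = br" "wt 0 = sq" "mt' 0 = br" "wt' 0 = sq"
    using assms(5,6) by (simp_all only: restricted_formal_deformation_def)
  \<comment> \<open>Expand \<open>sq (x + y)\<close> and \<open>sq (y + x)\<close> by the same axiom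
    and compare.\<close>
  have sym: "br x y = br y x" for x y
    using L.sq_add[of x y] L.sq_add[of y x] by (simp add: ac_simps)
  obtain phi where phi0: "phi 0 = id"
    and lin: "Vector_Spaces.linear scaleL scaleL (phi 1)"
    and eq_m: "\<And>x y. ext2 mt (ext1 phi (fps_const x)) (ext1 phi (fps_const y)) =
                 ext1 phi (ext2 mt' (fps_const x) (fps_const y))"
    and eq_w: "\<And>x. ext1 phi (ext_quad mt wt (fps_const x)) =
                 ext_quad mt' wt' (ext1 phi (fps_const x))"
    using assms(7) unfolding equivalent_deformations_def by blast
  \<comment> \<open>\<open>[simplified]\<close> turns the index 1 into \<open>Suc 0\<close>, the
    form in which the simplifier meets it.\<close>
  note coeffs = ext1_nth_0 ext1_nth_1[simplified] ext2_nth_0 ext2_nth_1[simplified]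
    ext_quad_nth_0 ext_quad_nth_1[simplified] base phi0 bilinear_on_zero[OF L.bilinear_br]
  have "br x (phi 1 y) + br (phi 1 x) y + mt 1 x y = mt' 1 x y + phi 1 (br x y)" for x y
    using arg_cong[OF eq_m[of x y], of "\<lambda>X. fps_nth X 1"] by (simp add: coeffs)
  \<comment> \<open>Solved for \<open>mt 1 x y\<close>, the equation serves as a rewrite rule;
    substituting it below makes \<open>mt' 1 x y\<close> occur twice and cancel.\<close>
  then have "mt 1 x y = mt' 1 x y + phi 1 (br x y) - (br x (phi 1 y) + br (phi 1 x) y)" for x y
    by (simp add: eq_diff_eq ac_simps)
  then have m: "mt 1 x y + mt' 1 x y = d1_CE br (phi 1) x y" for x y
    by (simp only: d1_CE_def sym[of y "phi 1 x"] diff ac_simps cancel)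
  \<comment> \<open>Here the primed map is applied after phi, while in \<open>eq_m\<close> phi is
    applied after the primed map. The resulting change of sign is invisible in characteristic 2, so
    the same \<open>phi 1\<close> serves both components.\<close>
  have "wt 1 x + phi 1 (sq x) = wt' 1 x + br x (phi 1 x)" for x
    using arg_cong[OF eq_w[of x], of "\<lambda>X. fps_nth X 1"] by (simp add: coeffs)
  then have "wt 1 x = wt' 1 x + br x (phi 1 x) - phi 1 (sq x)" for x
    by (simp add: eq_diff_eq)
  then have "wt 1 x + wt' 1 x = phi 1 (sq x) + br x (phi 1 x)" for x
    by (simp only: diff ac_simps cancel)
  with m have "((\<lambda>x y. mt 1 x y + mt' 1 x y), (\<lambda>x. wt 1 x + wt' 1 x)) =
      (d1_CE br (phi 1), \<lambda>x. phi 1 (sq x) + br x (phi 1 x))"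
    by (simp only: prod.inject fun_eq_iff simp_thms)
  with lin show ?thesis
    unfolding restricted_2_coboundaries_def by blast
qed

end
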